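(* Let $A$ be a self-adjoint operator with an infinite matrix representation $A_\infty$. Let $A_n$ be the leading principal $(n+1)\times(n+1)$ submatrix of $A_\infty$, and let $$\tilde A_n=\begin{bmatrix}A_n & 0\\ 0 & 0\end{bmatrix}$$ be the operator on $\ell^2$ obtained by extending $A_n$ by zeros. Then $\tilde A_n v\to A_\infty v$ as $n\to\infty$ for every $v\in\ell^2_0$, and $\tilde A_n$ converges to $A_\infty$ in the strong resolvent sense.
   Context: $\ell^2$ is the Hilbert space of absolutely square-summable sequences (indexed from $0$), $e_i$ are its standard basis vectors, and $\ell^2_0\subset\ell^2$ is the space of finite linear combinations of the $e_i$. A self-adjoint operator $A$ on a Hilbert space has an infinite matrix representation with respect to an orthonormal basis $\phi_0,\phi_1,\ldots$ of that space if $\phi_i$ lies in the domain of $A$ (i.e. $\|A\phi_i\|<\infty$) for all $i$. The matrix is $[A_\infty]_{i,j}=\langle\phi_i,A\phi_j\rangle$. By standing convention, $A_\infty$ is then regarded as an operator on $\ell^2$ acting by matrix multiplication with domain $D(A_\infty)=\{v\in\ell^2:\|A_\infty v\|<\infty\}$, this operator is self-adjoint, and it is identified with $A$ under the isomorphism $v\mapsto\sum_i v_i\phi_i$ (so that $D(A_\infty)$ corresponds to $D(A)$). Self-adjoint operators $B_n$ converge to a self-adjoint operator $B$ in the strong resolvent sense if $(B_n-z)^{-1}\to(B-z)^{-1}$ strongly for some nonreal $z$. *)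

theory Defs
  imports "HOL-Analysis.Analysis"
begin

section \<open>Complex Hilbert spaces\<close>

text \<open>
  The inner product \<open>cinner\<close> is linear in its second argument. The real inner product inherited
  from \<^class>\<open>real_inner\<close> is required to be the real part of \<open>cinner\<close>, so that
  \<open>norm x = sqrt (Re (cinner x x))\<close>; positivity of \<open>cinner\<close> comes from that of the real one.
\<close>

class complex_inner = real_inner +
  fixes scaleC :: "complex \<Rightarrow> 'a \<Rightarrow> 'a"  (infixr \<open>*\<^sub>C\<close> 75)
    and cinner :: "'a \<Rightarrow> 'a \<Rightarrow> complex"
  assumes scaleR_eq_scaleC: "r *\<^sub>R x = complex_of_real r *\<^sub>C x"
    and scaleC_add_right: "c *\<^sub>C (x + y) = c *\<^sub>C x + c *\<^sub>C y"
    and scaleC_add_left: "(c + d) *\<^sub>C x = c *\<^sub>C x + d *\<^sub>C x"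
    and scaleC_scaleC: "c *\<^sub>C d *\<^sub>C x = (c * d) *\<^sub>C x"
    and cinner_commute: "cinner x y = cnj (cinner y x)"
    and cinner_add_right: "cinner x (y + z) = cinner x y + cinner x z"
    and cinner_scaleC_right: "cinner x (c *\<^sub>C y) = c * cinner x y"
    and inner_eq_Re_cinner: "inner x y = Re (cinner x y)"

class chilbert_space = complex_inner + complete_space

global_interpretation complex_vector: vector_space "scaleC :: complex \<Rightarrow> 'a \<Rightarrow> 'a::complex_inner"
  defines csubspace = complex_vector.subspace
    and cspan = complex_vector.span
proof
  fix c d :: complex and x y :: 'a
  show "c *\<^sub>C (x + y) = c *\<^sub>C x + c *\<^sub>C y" by (rule scaleC_add_right)
  show "(c + d) *\<^sub>C x = c *\<^sub>C x + d *\<^sub>C x" by (rule scaleC_add_left)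
  show "c *\<^sub>C d *\<^sub>C x = (c * d) *\<^sub>C x" by (rule scaleC_scaleC)
  show "1 *\<^sub>C x = x" using scaleR_eq_scaleC [of 1 x] by simp
qed

definition orthonormal_basis :: "(nat \<Rightarrow> 'a::complex_inner) \<Rightarrow> bool" where
  "orthonormal_basis \<phi> \<longleftrightarrow>
     (\<forall>i j. cinner (\<phi> i) (\<phi> j) = (if i = j then 1 else 0)) \<and> closure (cspan (range \<phi>)) = UNIV"


section \<open>The space of square-summable sequences\<close>

typedef ell2 = "{v :: nat \<Rightarrow> complex. summable (\<lambda>i. (cmod (v i))\<^sup>2)}"
  morphisms coord Abs_ell2
  by (rule exI [of _ "\<lambda>_. 0"]) simp

setup_lifting type_definition_ell2

lemma summable_coord: "summable (\<lambda>i. (cmod (coord v i))\<^sup>2)"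
  using coord [of v] by simp

lemma ell2_eqI: "(\<And>i. coord v i = coord w i) \<Longrightarrow> v = w"
  by (simp add: coord_inject [symmetric] fun_eq_iff)

lemma square_summable_add:
  assumes "summable (\<lambda>i. (cmod (v i))\<^sup>2)" "summable (\<lambda>i. (cmod (w i))\<^sup>2)"
  shows "summable (\<lambda>i. (cmod (v i + w i))\<^sup>2)"
proof (rule summable_comparison_test')
  show "summable (\<lambda>i. 2 * (cmod (v i))\<^sup>2 + 2 * (cmod (w i))\<^sup>2)"
    using assms by (intro summable_add summable_mult)
  fix i
  have "(cmod (v i + w i))\<^sup>2 \<le> (cmod (v i) + cmod (w i))\<^sup>2"
    by (intro power_mono norm_triangle_ineq) simp
  also have "\<dots> \<le> 2 * (cmod (v i))\<^sup>2 + 2 * (cmod (w i))\<^sup>2"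
    using zero_le_power2 [of "cmod (v i) - cmod (w i)"]
    by (simp add: power2_sum power2_diff)
  finally show "norm ((cmod (v i + w i))\<^sup>2) \<le> 2 * (cmod (v i))\<^sup>2 + 2 * (cmod (w i))\<^sup>2"
    by simp
qed

lemma square_summable_mult:
  assumes "summable (\<lambda>i. (cmod (v i))\<^sup>2)"
  shows "summable (\<lambda>i. (cmod (c * v i))\<^sup>2)"
  using summable_mult [OF assms, of "(cmod c)\<^sup>2"] by (simp add: norm_mult power_mult_distrib)

lemma summable_cnj_mult:
  assumes "summable (\<lambda>i. (cmod (v i))\<^sup>2)" "summable (\<lambda>i. (cmod (w i))\<^sup>2)"
  shows "summable (\<lambda>i. cnj (v i) * w i)"
proof (rule summable_comparison_test')
  show "summable (\<lambda>i. (cmod (v i))\<^sup>2 + (cmod (w i))\<^sup>2)"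
    using assms by (rule summable_add)
  fix i
  have "2 * (cmod (v i) * cmod (w i)) \<le> (cmod (v i))\<^sup>2 + (cmod (w i))\<^sup>2"
    using sum_squares_bound [of "cmod (v i)" "cmod (w i)"] by simp
  moreover have "0 \<le> cmod (v i) * cmod (w i)" by simp
  ultimately show "norm (cnj (v i) * w i) \<le> (cmod (v i))\<^sup>2 + (cmod (w i))\<^sup>2"
    unfolding norm_mult complex_mod_cnj by linarith
qed

instantiation ell2 :: complex_inner
begin

lift_definition zero_ell2 :: ell2 is "\<lambda>_. 0" by simp

lift_definition plus_ell2 :: "ell2 \<Rightarrow> ell2 \<Rightarrow> ell2" is "\<lambda>v w i. v i + w i"
  by (rule square_summable_add)

lift_definition scaleC_ell2 :: "complex \<Rightarrow> ell2 \<Rightarrow> ell2" is "\<lambda>c v i. c * v i"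
  by (rule square_summable_mult)

definition "scaleR_ell2 r (v :: ell2) = complex_of_real r *\<^sub>C v"

definition "uminus_ell2 (v :: ell2) = (- 1) *\<^sub>C v"

definition "minus_ell2 (v :: ell2) w = v + - w"

definition "cinner_ell2 v w = (\<Sum>i. cnj (coord v i) * coord w i)"

definition "inner_ell2 (v :: ell2) w = Re (cinner v w)"

definition "norm_ell2 (v :: ell2) = sqrt (inner v v)"

definition "sgn_ell2 (v :: ell2) = inverse (norm v) *\<^sub>R v"

definition "dist_ell2 (v :: ell2) w = norm (v - w)"

definition "uniformity_ell2 = (INF e\<in>{0<..}. principal {(v :: ell2, w). dist v w < e})"

definition "open_ell2 U \<longleftrightarrow> (\<forall>v\<in>U. eventually (\<lambda>(v', w). v' = v \<longrightarrow> w \<in> U) (uniformity :: (ell2 \<times> ell2) filter))"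

instance
proof
  note simps = zero_ell2.rep_eq plus_ell2.rep_eq scaleC_ell2.rep_eq scaleR_ell2_def
    uminus_ell2_def minus_ell2_def algebra_simps
  fix u v w :: ell2 and r s :: real and c d :: complex
  show "u + v + w = u + (v + w)" by (rule ell2_eqI) (simp add: simps)
  show "u + v = v + u" by (rule ell2_eqI) (simp add: simps)
  show "0 + u = u" by (rule ell2_eqI) (simp add: simps)
  show "- u + u = 0" by (rule ell2_eqI) (simp add: simps)
  show "u - v = u + - v" by (simp add: minus_ell2_def)
  show "r *\<^sub>R (u + v) = r *\<^sub>R u + r *\<^sub>R v" by (rule ell2_eqI) (simp add: simps)
  show "(r + s) *\<^sub>R u = r *\<^sub>R u + s *\<^sub>R u" by (rule ell2_eqI) (simp add: simps)
  show "r *\<^sub>R s *\<^sub>R u = (r * s) *\<^sub>R u" by (rule ell2_eqI) (simp add: simps)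
  show "1 *\<^sub>R u = u" by (rule ell2_eqI) (simp add: simps)
  show "sgn u = inverse (norm u) *\<^sub>R u" by (rule sgn_ell2_def)
  show "dist u v = norm (u - v)" by (rule dist_ell2_def)
  show "uniformity = (INF e\<in>{0<..}. principal {(v :: ell2, w). dist v w < e})"
    by (rule uniformity_ell2_def)
  show "open U \<longleftrightarrow> (\<forall>v\<in>U. \<forall>\<^sub>F (v', w) in uniformity. v' = v \<longrightarrow> w \<in> U)" for U :: "ell2 set"
    by (rule open_ell2_def)
  show "r *\<^sub>R u = complex_of_real r *\<^sub>C u" by (rule scaleR_ell2_def)
  show "c *\<^sub>C (u + v) = c *\<^sub>C u + c *\<^sub>C v" by (rule ell2_eqI) (simp add: simps)
  show "(c + d) *\<^sub>C u = c *\<^sub>C u + d *\<^sub>C u" by (rule ell2_eqI) (simp add: simps)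
  show "c *\<^sub>C d *\<^sub>C u = (c * d) *\<^sub>C u" by (rule ell2_eqI) (simp add: simps)
  have summ: "summable (\<lambda>i. cnj (coord v i) * coord w i)" for v w
    by (intro summable_cnj_mult summable_coord)
  have commute: "cinner v w = cnj (cinner w v)" for v w :: ell2
    using bounded_linear.suminf [OF bounded_linear_cnj summ [of w v]]
    by (simp add: cinner_ell2_def mult.commute)
  show "cinner u v = cnj (cinner v u)" by (rule commute)
  have add: "cinner u (v + w) = cinner u v + cinner u w" for u v w :: ell2
    using suminf_add [OF summ [of u v] summ [of u w]]
    by (simp add: cinner_ell2_def plus_ell2.rep_eq distrib_left)
  show "cinner u (v + w) = cinner u v + cinner u w" by (rule add)
  have scale: "cinner u (c *\<^sub>C v) = c * cinner u v" for u v :: ell2 and c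
    using suminf_mult [OF summ [of u v], of c]
    by (simp add: cinner_ell2_def scaleC_ell2.rep_eq mult.left_commute)
  show "cinner u (c *\<^sub>C v) = c * cinner u v" by (rule scale)
  show "inner u v = Re (cinner u v)" by (rule inner_ell2_def)
  have icomm: "inner u v = inner v u" for u v :: ell2
    unfolding inner_ell2_def by (subst commute) simp
  show "inner u v = inner v u" by (rule icomm)
  have "inner w (u + v) = inner w u + inner w v" by (simp add: inner_ell2_def add)
  then show "inner (u + v) w = inner u w + inner v w" by (simp only: icomm)
  have "inner v (r *\<^sub>R u) = r * inner v u" by (simp add: inner_ell2_def scaleR_ell2_def scale)
  then show "inner (r *\<^sub>R u) v = r * inner u v" by (simp only: icomm)
  have "cinner u u = complex_of_real (\<Sum>i. (cmod (coord u i))\<^sup>2)"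
    unfolding suminf_of_real [OF summable_coord] cinner_ell2_def
    by (intro arg_cong [where f = suminf] ext) (simp add: complex_norm_square mult.commute del: of_real_power)
  then have iself: "inner u u = (\<Sum>i. (cmod (coord u i))\<^sup>2)"
    by (simp add: inner_ell2_def)
  show "0 \<le> inner u u" by (simp add: iself suminf_nonneg summable_coord)
  show "inner u u = 0 \<longleftrightarrow> u = 0"
  proof
    assume "inner u u = 0"
    then have "\<forall>i. (cmod (coord u i))\<^sup>2 = 0"
      using suminf_eq_zero_iff [OF summable_coord [of u]] by (simp add: iself)
    then show "u = 0" by (intro ell2_eqI) (simp add: zero_ell2.rep_eq)
  next
    assume "u = 0"
    then have "coord u i = 0" for i by (simp add: zero_ell2.rep_eq)
    then show "inner u u = 0" by (simp add: iself)
  qed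
  show "norm u = sqrt (inner u u)" by (rule norm_ell2_def)
qed

end

lemma coord_diff: "coord (v - w) i = coord v i - coord w i"
  unfolding minus_ell2_def uminus_ell2_def plus_ell2.rep_eq scaleC_ell2.rep_eq by simp

lemma norm_ell2_square: "(norm (v :: ell2))\<^sup>2 = (\<Sum>i. (cmod (coord v i))\<^sup>2)"
proof -
  have "cinner v v = complex_of_real (\<Sum>i. (cmod (coord v i))\<^sup>2)"
    unfolding suminf_of_real [OF summable_coord] cinner_ell2_def
    by (intro arg_cong [where f = suminf] ext) (simp add: complex_norm_square mult.commute del: of_real_power)
  then show ?thesis by (simp add: power2_norm_eq_inner inner_eq_Re_cinner)
qed

lemma norm_ell2: "norm (v :: ell2) = sqrt (\<Sum>i. (cmod (coord v i))\<^sup>2)"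
  by (simp flip: norm_ell2_square)

lemma sum_coord_le_norm: "(\<Sum>i<k. (cmod (coord v i))\<^sup>2) \<le> (norm v)\<^sup>2"
  unfolding norm_ell2_square by (rule sum_le_suminf [OF summable_coord]) auto

lemma cmod_coord_le_norm: "cmod (coord v i) \<le> norm v"
proof (rule power2_le_imp_le)
  have "(cmod (coord v i))\<^sup>2 \<le> (\<Sum>j<Suc i. (cmod (coord v j))\<^sup>2)"
    by (rule member_le_sum) auto
  then show "(cmod (coord v i))\<^sup>2 \<le> (norm v)\<^sup>2"
    using sum_coord_le_norm order_trans by blast
qed simp

instance ell2 :: chilbert_space
proof
  fix X :: "nat \<Rightarrow> ell2"
  assume X: "Cauchy X"
  have "Cauchy (\<lambda>n. coord (X n) i)" for i
  proof (rule metric_CauchyI)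
    fix e :: real assume "0 < e"
    then obtain N where N: "\<forall>m\<ge>N. \<forall>n\<ge>N. dist (X m) (X n) < e"
      using X metric_CauchyD by blast
    have "dist (coord (X m) i) (coord (X n) i) < e" if "m \<ge> N" "n \<ge> N" for m n
    proof -
      have "dist (coord (X m) i) (coord (X n) i) \<le> dist (X m) (X n)"
        unfolding dist_norm coord_diff [symmetric] by (rule cmod_coord_le_norm)
      also have "\<dots> < e" using N that by blast
      finally show ?thesis .
    qed
    then show "\<exists>N. \<forall>m\<ge>N. \<forall>n\<ge>N. dist (coord (X m) i) (coord (X n) i) < e" by blast
  qed
  then have "\<exists>l. (\<lambda>n. coord (X n) i) \<longlonglongrightarrow> l" for i
    by (simp add: Cauchy_convergent_iff convergent_def)
  then obtain L where L: "\<And>i. (\<lambda>n. coord (X n) i) \<longlonglongrightarrow> L i" by metis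
  have tail: "\<exists>N. \<forall>m\<ge>N. \<forall>k. (\<Sum>i<k. (cmod (coord (X m) i - L i))\<^sup>2) \<le> e\<^sup>2" if "0 < e" for e
  proof -
    obtain N where N: "\<forall>m\<ge>N. \<forall>n\<ge>N. dist (X m) (X n) < e"
      using X \<open>0 < e\<close> metric_CauchyD by blast
    have "(\<Sum>i<k. (cmod (coord (X m) i - L i))\<^sup>2) \<le> e\<^sup>2" if "m \<ge> N" for m k
    proof (rule LIMSEQ_le_const2)
      show "(\<lambda>n. \<Sum>i<k. (cmod (coord (X m) i - coord (X n) i))\<^sup>2)
              \<longlonglongrightarrow> (\<Sum>i<k. (cmod (coord (X m) i - L i))\<^sup>2)"
        by (intro tendsto_intros L)
      have "(\<Sum>i<k. (cmod (coord (X m) i - coord (X n) i))\<^sup>2) \<le> e\<^sup>2" if "n \<ge> N" for n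
      proof -
        have "(\<Sum>i<k. (cmod (coord (X m) i - coord (X n) i))\<^sup>2) \<le> (norm (X m - X n))\<^sup>2"
          using sum_coord_le_norm [where v = "X m - X n" and k = k] by (simp add: coord_diff)
        also have "\<dots> \<le> e\<^sup>2"
        proof (rule power_mono)
          have "dist (X m) (X n) < e" using N \<open>m \<ge> N\<close> \<open>n \<ge> N\<close> by blast
          then show "norm (X m - X n) \<le> e" by (simp add: dist_norm)
        qed simp
        finally show ?thesis .
      qed
      then show "\<exists>N. \<forall>n\<ge>N. (\<Sum>i<k. (cmod (coord (X m) i - coord (X n) i))\<^sup>2) \<le> e\<^sup>2" by blast
    qed
    then show ?thesis by blast
  qed
  have summ: "summable (\<lambda>i. (cmod (coord (X m) i - L i))\<^sup>2)"
    if "\<forall>k. (\<Sum>i<k. (cmod (coord (X m) i - L i))\<^sup>2) \<le> c" for m c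
    by (rule summableI_nonneg_bounded [of _ c]) (use that in \<open>simp_all only: zero_le_power2\<close>)
  obtain m where m: "\<forall>k. (\<Sum>i<k. (cmod (coord (X m) i - L i))\<^sup>2) \<le> 1\<^sup>2"
    using tail [of 1] by auto
  have "summable (\<lambda>i. (cmod (coord (X m) i + (- 1) * (coord (X m) i - L i)))\<^sup>2)"
    by (intro square_summable_add square_summable_mult summable_coord summ [OF m])
  then have "summable (\<lambda>i. (cmod (L i))\<^sup>2)" by simp
  then have coord_L: "coord (Abs_ell2 L) = L" by (simp add: Abs_ell2_inverse)
  have "X \<longlonglongrightarrow> Abs_ell2 L"
  proof (rule metric_LIMSEQ_I)
    fix r :: real assume "0 < r"
    then obtain N where N: "\<And>n k. n \<ge> N \<Longrightarrow> (\<Sum>i<k. (cmod (coord (X n) i - L i))\<^sup>2) \<le> (r / 2)\<^sup>2"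
      using tail [of "r / 2"] by auto
    have "dist (X n) (Abs_ell2 L) < r" if "n \<ge> N" for n
    proof -
      have "(norm (X n - Abs_ell2 L))\<^sup>2 \<le> (r / 2)\<^sup>2"
        unfolding norm_ell2_square coord_diff coord_L
      proof (rule suminf_le_const)
        show "summable (\<lambda>i. (cmod (coord (X n) i - L i))\<^sup>2)"
          by (rule summ [of n "(r / 2)\<^sup>2"]) (use N [OF that] in blast)
      qed (rule N [OF that])
      then have "norm (X n - Abs_ell2 L) \<le> r / 2"
        by (rule power2_le_imp_le) (use \<open>0 < r\<close> in simp)
      then show ?thesis using \<open>0 < r\<close> by (simp add: dist_norm)
    qed
    then show "\<exists>N. \<forall>n\<ge>N. dist (X n) (Abs_ell2 L) < r" by blast
  qed
  then show "convergent X" by (auto simp: convergent_def)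
qed

lift_definition std_basis :: "nat \<Rightarrow> ell2" is "\<lambda>k i. if i = k then 1 else 0"
  by (rule summable_finite [of "{k}" for k]) auto

definition ell2_finite :: "ell2 set" where
  "ell2_finite = cspan (range std_basis)"


section \<open>Unbounded operators\<close>

text \<open>The values of \<open>app T\<close> outside \<open>dom_of T\<close> carry no meaning.\<close>

record 'a unbounded_operator =
  dom_of :: "'a set"
  app :: "'a \<Rightarrow> 'a"

definition linear_operator :: "'a::complex_inner unbounded_operator \<Rightarrow> bool" where
  "linear_operator T \<longleftrightarrow> csubspace (dom_of T) \<and>
     (\<forall>x\<in>dom_of T. \<forall>y\<in>dom_of T. app T (x + y) = app T x + app T y) \<and>
     (\<forall>c. \<forall>x\<in>dom_of T. app T (c *\<^sub>C x) = c *\<^sub>C app T x)"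

text \<open>The \<open>THE\<close> below is well defined only if the domain of \<open>T\<close> is dense.\<close>

definition adjoint :: "'a::complex_inner unbounded_operator \<Rightarrow> 'a unbounded_operator" where
  "adjoint T =
     \<lparr>dom_of = {y. \<exists>z. \<forall>x\<in>dom_of T. cinner y (app T x) = cinner z x},
      app = (\<lambda>y. THE z. \<forall>x\<in>dom_of T. cinner y (app T x) = cinner z x)\<rparr>"

definition self_adjoint :: "'a::complex_inner unbounded_operator \<Rightarrow> bool" where
  "self_adjoint T \<longleftrightarrow> linear_operator T \<and> closure (dom_of T) = UNIV \<and>
     dom_of (adjoint T) = dom_of T \<and> (\<forall>x\<in>dom_of T. app (adjoint T) x = app T x)"

text \<open>
  \<open>resolvent T z\<close> is the inverse of \<open>T - z\<close>; it is meaningful when \<open>T - z\<close> maps the domain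
  of \<open>T\<close> bijectively onto the space, as is the case for self-adjoint \<open>T\<close> and nonreal \<open>z\<close>.
\<close>

definition resolvent :: "'a::complex_inner unbounded_operator \<Rightarrow> complex \<Rightarrow> 'a \<Rightarrow> 'a" where
  "resolvent T z = inv_into (dom_of T) (\<lambda>x. app T x - z *\<^sub>C x)"

definition strong_resolvent_convergence ::
    "(nat \<Rightarrow> 'a::complex_inner unbounded_operator) \<Rightarrow> 'a unbounded_operator \<Rightarrow> bool" where
  "strong_resolvent_convergence T S \<longleftrightarrow> (\<forall>n. self_adjoint (T n)) \<and> self_adjoint S \<and>
     (\<exists>z. Im z \<noteq> 0 \<and> (\<forall>x. (\<lambda>n. resolvent (T n) z x) \<longlonglongrightarrow> resolvent S z x))"


section \<open>Infinite matrices\<close>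

definition mat_vec :: "(nat \<Rightarrow> nat \<Rightarrow> complex) \<Rightarrow> ell2 \<Rightarrow> nat \<Rightarrow> complex" where
  "mat_vec M v i = (\<Sum>j. M i j * coord v j)"

definition matrix_operator :: "(nat \<Rightarrow> nat \<Rightarrow> complex) \<Rightarrow> ell2 unbounded_operator" where
  "matrix_operator M =
     \<lparr>dom_of = {v. (\<forall>i. summable (\<lambda>j. M i j * coord v j)) \<and>
                   summable (\<lambda>i. (cmod (mat_vec M v i))\<^sup>2)},
      app = (\<lambda>v. Abs_ell2 (mat_vec M v))\<rparr>"

definition infinite_matrix ::
    "'a::complex_inner unbounded_operator \<Rightarrow> (nat \<Rightarrow> 'a) \<Rightarrow> nat \<Rightarrow> nat \<Rightarrow> complex" where
  "infinite_matrix A \<phi> i j = cinner (\<phi> i) (app A (\<phi> j))"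

definition from_coords :: "(nat \<Rightarrow> 'a::complex_inner) \<Rightarrow> ell2 \<Rightarrow> 'a" where
  "from_coords \<phi> v = (\<Sum>i. coord v i *\<^sub>C \<phi> i)"

text \<open>
  The last three conjuncts express that the maximal matrix operator is identified with \<open>A\<close>.
  They do not follow from the first two: in general the maximal matrix operator is the adjoint of
  the restriction of \<open>A\<close> to the finite linear combinations of the \<open>\<phi> i\<close>, a proper extension
  of \<open>A\<close> unless that restriction is essentially self-adjoint.
\<close>

definition has_matrix_representation ::
    "'a::complex_inner unbounded_operator \<Rightarrow> (nat \<Rightarrow> 'a) \<Rightarrow> bool" where
  "has_matrix_representation A \<phi> \<longleftrightarrow>
     orthonormal_basis \<phi> \<and>
     (\<forall>i. \<phi> i \<in> dom_of A) \<and>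
     self_adjoint (matrix_operator (infinite_matrix A \<phi>)) \<and>
     from_coords \<phi> ` dom_of (matrix_operator (infinite_matrix A \<phi>)) = dom_of A \<and>
     (\<forall>v\<in>dom_of (matrix_operator (infinite_matrix A \<phi>)).
        from_coords \<phi> (app (matrix_operator (infinite_matrix A \<phi>)) v) = app A (from_coords \<phi> v))"

text \<open>The leading principal \<open>k \<times> k\<close> submatrix of \<open>M\<close>, extended by zeros.\<close>

definition zero_extended_section ::
    "nat \<Rightarrow> (nat \<Rightarrow> nat \<Rightarrow> complex) \<Rightarrow> nat \<Rightarrow> nat \<Rightarrow> complex" where
  "zero_extended_section k M i j = (if i < k \<and> j < k then M i j else 0)"

lemma dom_of_zero_extended_section:
  "dom_of (matrix_operator (zero_extended_section k M)) = UNIV"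
proof -
  have "summable (\<lambda>j. zero_extended_section k M i j * coord v j)" for i v
    by (rule summable_finite [of "{..<k}"]) (auto simp: zero_extended_section_def)
  moreover have "summable (\<lambda>i. (cmod (mat_vec (zero_extended_section k M) v i))\<^sup>2)" for v
    by (rule summable_finite [of "{..<k}"]) (auto simp: mat_vec_def zero_extended_section_def)
  ultimately show ?thesis by (simp add: matrix_operator_def)
qed

end

theory Submission
  imports Defs
begin

text \<open>
  Write \<open>B\<close> for the infinite matrix and also for its maximal operator, which is self-adjoint. By
  Bessel's inequality the columns of \<open>B\<close> are square-summable, so \<open>B\<close> is defined on all finite
  vectors. Its entries are therefore \<open>\<langle>e\<^sub>i, B e\<^sub>j\<rangle>\<close>, the matrix is Hermitian, and its finite sections
  are self-adjoint. For \<open>k > j\<close> the section of size \<open>k\<close> maps \<open>e\<^sub>j\<close> to a truncation of the \<open>j\<close>-th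
  column. Letting \<open>k\<close> grow and using linearity gives the convergence on finite vectors.

  Strong resolvent convergence follows from convergence on a core. Let \<open>B\<^sub>n v\<close> tend to \<open>B v\<close> for
  all \<open>v\<close> in \<open>D\<close>, where \<open>B\<^sub>n\<close> and \<open>B\<close> are self-adjoint, and put \<open>x = (B - z) v\<close> with \<open>v\<close> in \<open>D\<close>. Then
  \<open>(B\<^sub>n - z)\<^sup>-\<^sup>1 x - (B - z)\<^sup>-\<^sup>1 x = (B\<^sub>n - z)\<^sup>-\<^sup>1 (B v - B\<^sub>n v)\<close>, which tends to zero because the
  resolvents are bounded by \<open>1 / \<bar>Im z\<bar>\<close>. By the same bound it suffices that such \<open>x\<close> are dense
  (\<open>strong_resolvent_convergence_if_converges_on_core\<close>).

  It remains to see that the finite vectors are a core, that is, that \<open>B - z\<close> maps them onto a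
  dense subspace (\<open>ell2_finite_core\<close>). A vector \<open>y\<close> orthogonal to every \<open>(B - z) e\<^sub>j\<close> satisfies
  \<open>B y = cnj z *\<^sub>C y\<close> coordinatewise, since \<open>B\<close> is a Hermitian matrix. The domain of \<open>B\<close> is
  maximal, so \<open>y\<close> belongs to it and is an eigenvector for a nonreal eigenvalue of a self-adjoint
  operator; hence \<open>y = 0\<close>. Density then follows from the projection theorem
  (\<open>dense_if_orthogonal_complement_trivial\<close>), which together with the closedness of self-adjoint
  operators also makes the resolvents everywhere defined (\<open>self_adjoint_shifted_bij\<close>).
\<close>

section \<open>Inner product and orthogonal complement\<close>

lemma cinner_add_left: "cinner (x + y) z = cinner x z + cinner y (z :: 'a::complex_inner)"
  using cinner_add_right [of z x y] by (metis cinner_commute complex_cnj_add)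

lemma cinner_scaleC_left: "cinner (c *\<^sub>C x) y = cnj c * cinner x (y :: 'a::complex_inner)"
  using cinner_scaleC_right [of y c x] by (metis cinner_commute complex_cnj_mult)

lemma additive_cinner_right: "Modules.additive (cinner (x :: 'a::complex_inner))"
  by unfold_locales (rule cinner_add_right)

lemma additive_cinner_left: "Modules.additive (\<lambda>x. cinner x (y :: 'a::complex_inner))"
  by unfold_locales (rule cinner_add_left)

lemmas cinner_diff_right = Modules.additive.diff [OF additive_cinner_right]
lemmas cinner_diff_left = Modules.additive.diff [OF additive_cinner_left]
lemmas cinner_sum_right = Modules.additive.sum [OF additive_cinner_right]
lemmas cinner_sum_left = Modules.additive.sum [OF additive_cinner_left]

lemma cinner_self: "cinner x x = complex_of_real ((norm (x :: 'a::complex_inner))\<^sup>2)"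
proof -
  have "Im (cinner x x) = 0"
    using cinner_commute [of x x] by (metis Reals_cnj_iff complex_is_Real_iff)
  then show ?thesis
    by (simp add: complex_eq_iff power2_norm_eq_inner inner_eq_Re_cinner)
qed

lemma norm_scaleC: "norm (c *\<^sub>C x) = cmod c * norm (x :: 'a::complex_inner)"
proof -
  have "cinner (c *\<^sub>C x) (c *\<^sub>C x) = c * cnj c * cinner x x"
    by (simp only: cinner_scaleC_left cinner_scaleC_right mult_ac)
  also have "\<dots> = complex_of_real ((cmod c * norm x)\<^sup>2)"
    by (simp add: cinner_self power_mult_distrib flip: complex_norm_square)
  finally have "cinner (c *\<^sub>C x) (c *\<^sub>C x) = complex_of_real ((cmod c * norm x)\<^sup>2)" .
  then have "(norm (c *\<^sub>C x))\<^sup>2 = (cmod c * norm x)\<^sup>2"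
    unfolding cinner_self of_real_eq_iff .
  then show ?thesis by simp
qed

text \<open>
  Rotating the second argument by a phase makes the complex inner product real and nonnegative,
  which reduces the inequality to the real Cauchy-Schwarz inequality.
\<close>

lemma cmod_cinner_le: "cmod (cinner x y) \<le> norm x * norm (y :: 'a::complex_inner)"
proof (cases "cinner x y = 0")
  case False
  define c where "c = cnj (cinner x y) / cmod (cinner x y)"
  have c: "cmod c = 1" using False by (simp add: c_def norm_divide)
  have "c * cinner x y = complex_of_real (cmod (cinner x y))"
    using False complex_norm_square [of "cinner x y"]
    by (simp add: c_def field_simps power2_eq_square)
  then have "cmod (cinner x y) = inner x (c *\<^sub>C y)"
    by (simp add: inner_eq_Re_cinner cinner_scaleC_right)
  also have "\<dots> \<le> norm x * norm (c *\<^sub>C y)" by (rule norm_cauchy_schwarz)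
  finally show ?thesis by (simp add: norm_scaleC c)
qed simp

lemma bounded_linear_cinner_right: "bounded_linear (cinner (x :: 'a::complex_inner))"
proof (rule bounded_linear_intro [where K = "norm x"])
  show "norm (cinner x y) \<le> norm y * norm x" for y
    using cmod_cinner_le [of x y] by (simp add: mult.commute)
qed (simp_all add: cinner_add_right scaleR_eq_scaleC cinner_scaleC_right scaleR_conv_of_real)

lemma bounded_linear_scaleC_right: "bounded_linear (scaleC c :: 'a::complex_inner \<Rightarrow> 'a)"
proof (rule bounded_linear_intro [where K = "cmod c"])
  show "norm (c *\<^sub>C x) \<le> norm x * cmod c" for x :: 'a
    by (simp add: norm_scaleC mult.commute)
qed (simp_all add: scaleC_add_right scaleR_eq_scaleC scaleC_scaleC mult.commute)

lemmas tendsto_cinner_right = bounded_linear.tendsto [OF bounded_linear_cinner_right]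
lemmas tendsto_scaleC_right = bounded_linear.tendsto [OF bounded_linear_scaleC_right]

lemma tendsto_cinner_left:
  assumes "(f \<longlongrightarrow> l) F"
  shows "((\<lambda>n. cinner (f n) (y :: 'a::complex_inner)) \<longlongrightarrow> cinner l y) F"
  using tendsto_cnj [OF tendsto_cinner_right [OF assms, of y]]
  by (simp only: cinner_commute [symmetric])

lemma orthogonal_to_dense_imp_zero:
  fixes y :: "'a::complex_inner"
  assumes "closure D = UNIV" and "\<And>x. x \<in> D \<Longrightarrow> cinner y x = 0"
  shows "y = 0"
proof -
  obtain s where s: "\<And>n. s n \<in> D" "s \<longlonglongrightarrow> y"
    using assms(1) closure_sequential [of y D] by auto
  have "(\<lambda>n. 0) \<longlonglongrightarrow> cinner y y"
    using tendsto_cinner_right [OF s(2), of y] by (simp add: assms(2) [OF s(1)])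
  then have "cinner y y = 0" by (simp add: LIMSEQ_const_iff)
  then show ?thesis by (simp add: cinner_self)
qed

text \<open>
  This is the projection theorem in the form needed for density arguments. A sequence in the
  subspace that minimises the distance to a given point is Cauchy by the parallelogram law, and
  the difference between the point and the limit is orthogonal to the subspace.
\<close>

lemma dense_if_orthogonal_complement_trivial:
  fixes S :: "'a::chilbert_space set"
  assumes sub: "csubspace S"
    and triv: "\<And>y. (\<And>x. x \<in> S \<Longrightarrow> cinner y x = 0) \<Longrightarrow> y = 0"
  shows "closure S = UNIV"
proof -
  have "x \<in> closure S" for x
  proof -
    have S0: "0 \<in> S" using sub by (rule complex_vector.subspace_0)
    have scaleR_S: "r *\<^sub>R v \<in> S" if "v \<in> S" for r v
      unfolding scaleR_eq_scaleC by (rule complex_vector.subspace_scale [OF sub that])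
    define d where "d = infdist x S"
    have d_le: "d\<^sup>2 \<le> (norm (x - s))\<^sup>2" if "s \<in> S" for s
      using infdist_le [OF that, of x] infdist_nonneg [of x S]
      by (intro power_mono) (simp_all add: d_def dist_norm)
    \<comment> \<open>The excess is measured in the squared distance, as in the parallelogram law.\<close>
    have "\<exists>s\<in>S. (norm (x - s))\<^sup>2 < d\<^sup>2 + inverse (real (Suc n))" for n
    proof -
      have "sqrt (d\<^sup>2) < sqrt (d\<^sup>2 + inverse (real (Suc n)))"
        by (intro real_sqrt_less_mono) simp
      then have "infdist x S < sqrt (d\<^sup>2 + inverse (real (Suc n)))"
        using infdist_nonneg [of x S] by (simp add: d_def)
      then obtain s where s: "s \<in> S" "dist x s < sqrt (d\<^sup>2 + inverse (real (Suc n)))"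
        using S0 by (auto simp: infdist_def cINF_less_iff split: if_splits)
      then have "(norm (x - s))\<^sup>2 < (sqrt (d\<^sup>2 + inverse (real (Suc n))))\<^sup>2"
        by (intro power_strict_mono) (simp_all add: dist_norm)
      then show ?thesis using s(1) by (intro bexI [of _ s]) simp_all
    qed
    then obtain s where s: "\<And>n. s n \<in> S"
      and s_lt: "\<And>n. (norm (x - s n))\<^sup>2 < d\<^sup>2 + inverse (real (Suc n))"
      by metis
    have close: "(norm (s m - s n))\<^sup>2 < 2 * inverse (real (Suc m)) + 2 * inverse (real (Suc n))"
      for m n
    proof -
      have "(1/2) *\<^sub>R (s m + s n) \<in> S"
        by (intro scaleR_S complex_vector.subspace_add [OF sub] s)
      then have "d\<^sup>2 \<le> (norm (x - (1/2) *\<^sub>R (s m + s n)))\<^sup>2" by (rule d_le)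
      moreover have "(norm (s m - s n))\<^sup>2 = 2 * (norm (x - s m))\<^sup>2 + 2 * (norm (x - s n))\<^sup>2
          - 4 * (norm (x - (1/2) *\<^sub>R (s m + s n)))\<^sup>2"
        unfolding power2_norm_eq_inner
        by (simp add: inner_diff_left inner_diff_right inner_add_left inner_add_right
            inner_commute algebra_simps)
      ultimately show ?thesis using s_lt [of m] s_lt [of n] by linarith
    qed
    have "Cauchy s"
    proof (rule metric_CauchyI)
      fix e :: real assume "0 < e"
      then have "0 < e\<^sup>2 / 4" by simp
      then obtain N where N: "inverse (real (Suc N)) < e\<^sup>2 / 4"
        using reals_Archimedean by blast
      have "dist (s m) (s n) < e" if "m \<ge> N" "n \<ge> N" for m n
      proof (rule power2_less_imp_less)
        have "inverse (real (Suc m)) \<le> inverse (real (Suc N))"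
          "inverse (real (Suc n)) \<le> inverse (real (Suc N))"
          using that by (simp_all add: field_simps)
        then show "(dist (s m) (s n))\<^sup>2 < e\<^sup>2"
          using close [of m n] N unfolding dist_norm by linarith
      qed (use \<open>0 < e\<close> in simp)
      then show "\<exists>N. \<forall>m\<ge>N. \<forall>n\<ge>N. dist (s m) (s n) < e" by blast
    qed
    then obtain p where p: "s \<longlonglongrightarrow> p"
      by (auto simp: Cauchy_convergent_iff convergent_def)
    have "(norm (x - p))\<^sup>2 \<le> d\<^sup>2 + 0"
    proof (rule LIMSEQ_le)
      show "(\<lambda>n. (norm (x - s n))\<^sup>2) \<longlonglongrightarrow> (norm (x - p))\<^sup>2"
        by (intro tendsto_intros p)
      show "(\<lambda>n. d\<^sup>2 + inverse (real (Suc n))) \<longlonglongrightarrow> d\<^sup>2 + 0"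
        by (intro tendsto_intros LIMSEQ_inverse_real_of_nat)
      show "\<exists>N. \<forall>n\<ge>N. (norm (x - s n))\<^sup>2 \<le> d\<^sup>2 + inverse (real (Suc n))"
        using s_lt less_imp_le by blast
    qed
    moreover have "d\<^sup>2 \<le> (norm (x - p - w))\<^sup>2" if "w \<in> S" for w
    proof (rule LIMSEQ_le_const)
      show "(\<lambda>n. (norm (x - s n - w))\<^sup>2) \<longlonglongrightarrow> (norm (x - p - w))\<^sup>2"
        by (intro tendsto_intros p)
      have "d\<^sup>2 \<le> (norm (x - s n - w))\<^sup>2" for n
        using d_le [OF complex_vector.subspace_add [OF sub s that], of n]
        by (simp add: diff_diff_eq)
      then show "\<exists>N. \<forall>n\<ge>N. d\<^sup>2 \<le> (norm (x - s n - w))\<^sup>2" by blast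
    qed
    ultimately have min: "(norm (x - p))\<^sup>2 \<le> (norm (x - p - w))\<^sup>2" if "w \<in> S" for w
      using that by (metis add_0_right order_trans)
    have inner0: "inner (x - p) w = 0" if "w \<in> S" for w
    proof (cases "w = 0")
      case False
      \<comment> \<open>The best real multiple of \<open>w\<close> would improve the approximation \<open>p\<close>.\<close>
      define t where "t = inner (x - p) w / (norm w)\<^sup>2"
      have "(norm (x - p - t *\<^sub>R w))\<^sup>2
          = (norm (x - p))\<^sup>2 - 2 * t * inner (x - p) w + t\<^sup>2 * (norm w)\<^sup>2"
        unfolding power2_norm_eq_inner
        by (simp add: inner_diff_left inner_diff_right inner_commute algebra_simps
            power2_eq_square)
      also have "\<dots> = (norm (x - p))\<^sup>2 - (inner (x - p) w)\<^sup>2 / (norm w)\<^sup>2"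
        using False by (simp add: t_def field_simps power2_eq_square)
      finally have "(inner (x - p) w)\<^sup>2 / (norm w)\<^sup>2 \<le> 0"
        using min [OF scaleR_S [OF that], of t] by simp
      then show ?thesis using False by (simp add: divide_le_0_iff)
    qed simp
    have "x - p = 0"
    proof (rule triv)
      fix w assume w: "w \<in> S"
      have "Re (cinner (x - p) w) = 0"
        using inner0 [OF w] by (simp add: inner_eq_Re_cinner)
      moreover have "Re (cinner (x - p) (\<i> *\<^sub>C w)) = 0"
        using inner0 [OF complex_vector.subspace_scale [OF sub w]] by (simp add: inner_eq_Re_cinner)
      ultimately show "cinner (x - p) w = 0"
        by (simp add: cinner_scaleC_right complex_eq_iff)
    qed
    then show ?thesis using s p closure_sequential by auto
  qed
  then show ?thesis by auto
qed


section \<open>Resolvents of self-adjoint operators\<close>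

text \<open>
  This removes the definite description from the definition of the adjoint, whose value is unique
  because the domain is dense. The last two conjuncts say that the adjoint extends \<open>T\<close> and that
  \<open>T\<close> extends the adjoint; the latter is what puts a vector into the domain of \<open>T\<close> below.
\<close>

lemma self_adjoint_iff:
  "self_adjoint T \<longleftrightarrow> linear_operator T \<and> closure (dom_of T) = UNIV \<and>
     (\<forall>y\<in>dom_of T. \<forall>x\<in>dom_of T. cinner y (app T x) = cinner (app T y) x) \<and>
     (\<forall>y z. (\<forall>x\<in>dom_of T. cinner y (app T x) = cinner z x) \<longrightarrow> y \<in> dom_of T \<and> app T y = z)"
proof (cases "closure (dom_of T) = UNIV")
  case True
  define P where "P y z \<longleftrightarrow> (\<forall>x\<in>dom_of T. cinner y (app T x) = cinner z x)" for y z
  have unique: "z = z'" if "P y z" "P y z'" for y z z'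
  proof -
    have "z - z' = 0"
      using True that by (intro orthogonal_to_dense_imp_zero [of "dom_of T"])
        (simp_all add: P_def cinner_diff_left)
    then show ?thesis by simp
  qed
  have adj: "app (adjoint T) y = z" if "P y z" for y z
    using that unique unfolding adjoint_def P_def [symmetric]
    by (auto intro!: the_equality)
  have dom: "y \<in> dom_of (adjoint T) \<longleftrightarrow> (\<exists>z. P y z)" for y
    by (simp add: adjoint_def P_def)
  have eq: "dom_of (adjoint T) = dom_of T \<and> (\<forall>x\<in>dom_of T. app (adjoint T) x = app T x)
      \<longleftrightarrow> (\<forall>y\<in>dom_of T. P y (app T y)) \<and> (\<forall>y z. P y z \<longrightarrow> y \<in> dom_of T \<and> app T y = z)"
  proof (intro iffI conjI ballI allI impI)
    assume l: "dom_of (adjoint T) = dom_of T \<and> (\<forall>x\<in>dom_of T. app (adjoint T) x = app T x)"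
    show "P y (app T y)" if "y \<in> dom_of T" for y using l adj dom that by metis
    show "y \<in> dom_of T" "app T y = z" if "P y z" for y z using l adj dom that by metis+
  next
    assume r: "(\<forall>y\<in>dom_of T. P y (app T y)) \<and> (\<forall>y z. P y z \<longrightarrow> y \<in> dom_of T \<and> app T y = z)"
    show "dom_of (adjoint T) = dom_of T" using r dom by blast
    show "app (adjoint T) x = app T x" if "x \<in> dom_of T" for x using r adj that by blast
  qed
  show ?thesis
    by (simp only: self_adjoint_def True eq [unfolded P_def] simp_thms)
qed (simp add: self_adjoint_def)

lemma self_adjoint_symmetric:
  "self_adjoint T \<Longrightarrow> x \<in> dom_of T \<Longrightarrow> y \<in> dom_of T \<Longrightarrow> cinner y (app T x) = cinner (app T y) x"
  unfolding self_adjoint_iff by blast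

lemma self_adjoint_maximal:
  assumes "self_adjoint T" and "\<And>x. x \<in> dom_of T \<Longrightarrow> cinner y (app T x) = cinner z x"
  shows "y \<in> dom_of T" and "app T y = z"
  using assms unfolding self_adjoint_iff by blast+

lemma linear_operator_diff:
  assumes "linear_operator T" "x \<in> dom_of T" "y \<in> dom_of T"
  shows "x - y \<in> dom_of T" and "app T (x - y) = app T x - app T y"
proof -
  have sub: "csubspace (dom_of T)" using assms(1) by (simp add: linear_operator_def)
  show xy: "x - y \<in> dom_of T" using complex_vector.subspace_diff [OF sub] assms(2,3) .
  have "app T ((x - y) + y) = app T (x - y) + app T y"
    using assms(1,3) xy unfolding linear_operator_def by blast
  then show "app T (x - y) = app T x - app T y" by simp
qed

lemma csubspace_image_shifted_operator:
  assumes T: "linear_operator T" and S: "csubspace S" "S \<subseteq> dom_of T"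
  shows "csubspace ((\<lambda>x. app T x - z *\<^sub>C x) ` S)"
proof (rule complex_vector.subspaceI)
  let ?f = "\<lambda>x. app T x - z *\<^sub>C x"
  have scale: "?f (c *\<^sub>C x) = c *\<^sub>C ?f x" if "x \<in> S" for c x
  proof -
    have "app T (c *\<^sub>C x) = c *\<^sub>C app T x"
      using T S(2) that unfolding linear_operator_def by blast
    then show ?thesis
      by (simp add: complex_vector.scale_right_diff_distrib scaleC_scaleC mult.commute)
  qed
  have add: "?f (x + y) = ?f x + ?f y" if "x \<in> S" "y \<in> S" for x y
  proof -
    have "app T (x + y) = app T x + app T y"
      using T S(2) that unfolding linear_operator_def by blast
    then show ?thesis by (simp add: scaleC_add_right)
  qed
  have "0 \<in> S" using S(1) by (rule complex_vector.subspace_0)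
  then have "0 = ?f 0" using scale [of 0 0] by simp
  then show "0 \<in> ?f ` S" using \<open>0 \<in> S\<close> by (rule image_eqI)
  show "u + v \<in> ?f ` S" if uv: "u \<in> ?f ` S" "v \<in> ?f ` S" for u v
  proof -
    obtain x y where xy: "x \<in> S" "y \<in> S" "u = ?f x" "v = ?f y" using uv by blast
    then have "u + v = ?f (x + y)" using add by simp
    then show ?thesis
      using complex_vector.subspace_add [OF S(1) xy(1,2)] by (rule image_eqI)
  qed
  show "c *\<^sub>C u \<in> ?f ` S" if u: "u \<in> ?f ` S" for c u
  proof -
    obtain x where x: "x \<in> S" "u = ?f x" using u by blast
    then have "c *\<^sub>C u = ?f (c *\<^sub>C x)" using scale by simp
    then show ?thesis
      using complex_vector.subspace_scale [OF S(1) x(1)] by (rule image_eqI)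
  qed
qed

text \<open>
  Since \<open>cinner x (app T x)\<close> is real, the imaginary part of the inner product of \<open>x\<close> with
  \<open>app T x - z *\<^sub>C x\<close> comes from the shift alone.
\<close>

lemma norm_shifted_ge:
  assumes T: "self_adjoint T" and x: "x \<in> dom_of T"
  shows "\<bar>Im z\<bar> * norm x \<le> norm (app T x - z *\<^sub>C x)"
proof (cases "x = 0")
  case False
  have "cinner x (app T x) = cnj (cinner x (app T x))"
    using self_adjoint_symmetric [OF T x x] cinner_commute by metis
  then have "Im (cinner x (app T x)) = 0"
    by (metis Reals_cnj_iff complex_is_Real_iff)
  then have "Im (cinner x (app T x - z *\<^sub>C x)) = - Im z * (norm x)\<^sup>2"
    by (simp add: cinner_diff_right cinner_scaleC_right cinner_self)
  then have "\<bar>Im z\<bar> * (norm x)\<^sup>2 \<le> cmod (cinner x (app T x - z *\<^sub>C x))"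
    using abs_Im_le_cmod [of "cinner x (app T x - z *\<^sub>C x)"] by (simp add: abs_mult)
  also have "\<dots> \<le> norm x * norm (app T x - z *\<^sub>C x)" by (rule cmod_cinner_le)
  finally have "norm x * (\<bar>Im z\<bar> * norm x) \<le> norm x * norm (app T x - z *\<^sub>C x)"
    by (simp add: power2_eq_square mult.left_commute)
  then show ?thesis using False by simp
qed simp

text \<open>
  An eigenvector for a nonreal eigenvalue would contradict the lower bound. Applied to
  \<open>cnj z\<close>, this makes the orthogonal complement of the range of \<open>T - z\<close> trivial.
\<close>

lemma self_adjoint_no_nonreal_eigenvalue:
  assumes "self_adjoint T" "x \<in> dom_of T" "app T x = z *\<^sub>C x" "Im z \<noteq> 0"
  shows "x = 0"
  using norm_shifted_ge [OF assms(1,2), of z] assms(3,4) by (simp add: mult_le_0_iff)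

lemma self_adjoint_closed:
  assumes T: "self_adjoint T" and u: "\<And>n. u n \<in> dom_of T"
    and "u \<longlonglongrightarrow> v" and "(\<lambda>n. app T (u n)) \<longlonglongrightarrow> w"
  shows "v \<in> dom_of T" and "app T v = w"
proof -
  have eq: "cinner v (app T x) = cinner w x" if "x \<in> dom_of T" for x
  proof (rule LIMSEQ_unique)
    show "(\<lambda>n. cinner (u n) (app T x)) \<longlonglongrightarrow> cinner v (app T x)"
      by (rule tendsto_cinner_left [OF assms(3)])
    show "(\<lambda>n. cinner (u n) (app T x)) \<longlonglongrightarrow> cinner w x"
      using tendsto_cinner_left [OF assms(4)] self_adjoint_symmetric [OF T that u] by simp
  qed
  show "v \<in> dom_of T" and "app T v = w"
    by (rule self_adjoint_maximal [OF T eq], assumption)+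
qed

text \<open>
  The lower bound gives injectivity and, because \<open>T\<close> is closed, a closed range. The range is
  dense because a vector orthogonal to it would be an eigenvector of the adjoint \<open>T\<close> for the
  eigenvalue \<open>cnj z\<close>.
\<close>

lemma self_adjoint_shifted_bij:
  fixes T :: "'a::chilbert_space unbounded_operator"
  assumes T: "self_adjoint T" and z: "Im z \<noteq> 0"
  shows "bij_betw (\<lambda>x. app T x - z *\<^sub>C x) (dom_of T) UNIV"
proof -
  let ?f = "\<lambda>x. app T x - z *\<^sub>C x"
  have lin: "linear_operator T" using T by (simp add: self_adjoint_def)
  have f_diff: "?f x - ?f y = ?f (x - y)" if "x \<in> dom_of T" "y \<in> dom_of T" for x y
    using linear_operator_diff [OF lin that]
    by (simp add: complex_vector.scale_right_diff_distrib)
  have lower: "\<bar>Im z\<bar> * norm (x - y) \<le> norm (?f x - ?f y)"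
    if "x \<in> dom_of T" "y \<in> dom_of T" for x y
    unfolding f_diff [OF that]
    by (rule norm_shifted_ge [OF T linear_operator_diff(1) [OF lin that]])
  have "inj_on ?f (dom_of T)"
  proof (rule inj_onI)
    fix x y assume "x \<in> dom_of T" "y \<in> dom_of T" "?f x = ?f y"
    then have "\<bar>Im z\<bar> * norm (x - y) \<le> 0" using lower [of x y] by simp
    then show "x = y" using z by (simp add: mult_le_0_iff)
  qed
  moreover have "closure (?f ` dom_of T) = UNIV"
  proof (rule dense_if_orthogonal_complement_trivial)
    show "csubspace (?f ` dom_of T)"
      using lin by (intro csubspace_image_shifted_operator) (simp_all add: linear_operator_def)
    fix y assume perp: "\<And>x. x \<in> ?f ` dom_of T \<Longrightarrow> cinner y x = 0"
    have eq: "cinner y (app T x) = cinner (cnj z *\<^sub>C y) x" if "x \<in> dom_of T" for x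
      using perp [OF imageI [OF that]]
      by (simp add: cinner_diff_right cinner_scaleC_right cinner_scaleC_left)
    show "y = 0"
      by (rule self_adjoint_no_nonreal_eigenvalue [OF T self_adjoint_maximal [OF T eq]])
        (use z in simp_all)
  qed
  moreover have "f \<in> ?f ` dom_of T" if f: "f \<in> closure (?f ` dom_of T)" for f
  proof -
    obtain s where s: "\<And>n. s n \<in> ?f ` dom_of T" and s_lim: "s \<longlonglongrightarrow> f"
      using f unfolding closure_sequential by blast
    then obtain u where u: "\<And>n. u n \<in> dom_of T" "\<And>n. s n = ?f (u n)"
      unfolding image_iff by metis
    have "Cauchy u"
    proof (rule metric_CauchyI)
      fix e :: real assume "0 < e"
      then obtain N where N: "\<forall>m\<ge>N. \<forall>n\<ge>N. dist (s m) (s n) < \<bar>Im z\<bar> * e"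
        using metric_CauchyD [OF LIMSEQ_imp_Cauchy [OF s_lim], of "\<bar>Im z\<bar> * e"] z by auto
      have "dist (u m) (u n) < e" if "m \<ge> N" "n \<ge> N" for m n
      proof -
        have "\<bar>Im z\<bar> * norm (u m - u n) < \<bar>Im z\<bar> * e"
          using lower [OF u(1) u(1), of m n] N that unfolding u(2) [symmetric] dist_norm
          by (meson le_less_trans)
        then show ?thesis using z by (simp add: dist_norm)
      qed
      then show "\<exists>N. \<forall>m\<ge>N. \<forall>n\<ge>N. dist (u m) (u n) < e" by blast
    qed
    then obtain v where v: "u \<longlonglongrightarrow> v" by (auto simp: Cauchy_convergent_iff convergent_def)
    have Tu: "app T (u n) = s n + z *\<^sub>C u n" for n using u(2) [of n] by simp
    have lim: "(\<lambda>n. app T (u n)) \<longlonglongrightarrow> f + z *\<^sub>C v"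
      unfolding Tu by (intro tendsto_add s_lim tendsto_scaleC_right v)
    have "v \<in> dom_of T" "f = ?f v"
      using self_adjoint_closed [OF T u(1) v lim] by simp_all
    then show ?thesis by blast
  qed
  ultimately show ?thesis by (auto simp: bij_betw_def)
qed

lemma resolvent_in_dom:
  fixes T :: "'a::chilbert_space unbounded_operator"
  assumes "self_adjoint T" "Im z \<noteq> 0"
  shows "resolvent T z x \<in> dom_of T"
  using self_adjoint_shifted_bij [OF assms] unfolding resolvent_def bij_betw_def
  by (intro inv_into_into) simp

lemma shifted_resolvent:
  fixes T :: "'a::chilbert_space unbounded_operator"
  assumes "self_adjoint T" "Im z \<noteq> 0"
  shows "app T (resolvent T z x) - z *\<^sub>C resolvent T z x = x"
  using bij_betw_inv_into_right [OF self_adjoint_shifted_bij [OF assms], of x]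
  by (simp add: resolvent_def)

lemma norm_resolvent_minus_le:
  fixes T :: "'a::chilbert_space unbounded_operator"
  assumes T: "self_adjoint T" and z: "Im z \<noteq> 0" and v: "v \<in> dom_of T"
  shows "norm (resolvent T z x - v) \<le> norm (x - (app T v - z *\<^sub>C v)) / \<bar>Im z\<bar>"
proof -
  let ?r = "resolvent T z x"
  have lin: "linear_operator T" using T by (simp add: self_adjoint_def)
  note diff = linear_operator_diff [OF lin resolvent_in_dom [OF T z, of x] v]
  have "app T (?r - v) - z *\<^sub>C (?r - v) = (app T ?r - z *\<^sub>C ?r) - (app T v - z *\<^sub>C v)"
    by (simp add: diff complex_vector.scale_right_diff_distrib)
  then have "\<bar>Im z\<bar> * norm (?r - v) \<le> norm (x - (app T v - z *\<^sub>C v))"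
    using norm_shifted_ge [OF T diff(1), of z] by (simp add: shifted_resolvent [OF T z])
  then show ?thesis using z by (simp add: field_simps)
qed

text \<open>
  For a subspace \<open>D\<close>, the hypothesis that \<open>S - z\<close> maps \<open>D\<close> onto a dense set says that \<open>D\<close> is a
  core of \<open>S\<close>. An arbitrary \<open>x\<close> is approximated by \<open>(S - z) v\<close> with \<open>v\<close> in \<open>D\<close>; both resolvents at \<open>x\<close> are then
  close to \<open>v\<close>, the error for \<open>T n\<close> being controlled by \<open>T n v - S v\<close>. The bound
  \<open>1 / \<bar>Im z\<bar>\<close> of the resolvents is uniform in \<open>n\<close>.
\<close>

lemma strong_resolvent_convergence_if_converges_on_core:
  fixes S :: "'a::chilbert_space unbounded_operator"
  assumes T: "\<And>n. self_adjoint (T n)" and S: "self_adjoint S" and z: "Im z \<noteq> 0"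
    and D: "D \<subseteq> dom_of S" "\<And>n. D \<subseteq> dom_of (T n)"
    and core: "closure ((\<lambda>v. app S v - z *\<^sub>C v) ` D) = UNIV"
    and conv: "\<And>v. v \<in> D \<Longrightarrow> (\<lambda>n. app (T n) v) \<longlonglongrightarrow> app S v"
  shows "strong_resolvent_convergence T S"
proof -
  have "(\<lambda>n. resolvent (T n) z x) \<longlonglongrightarrow> resolvent S z x" for x
  proof (rule metric_LIMSEQ_I)
    fix e :: real assume "0 < e"
    \<comment> \<open>Approximating \<open>x\<close> up to \<open>\<delta>\<close> costs \<open>e / 3\<close> for \<open>S\<close> and, together with an error \<open>\<delta>\<close> between
      \<open>T n v\<close> and \<open>S v\<close>, \<open>2 * e / 3\<close> for \<open>T n\<close>.\<close>
    define \<delta> where "\<delta> = \<bar>Im z\<bar> * e / 3"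
    have "0 < \<delta>" using \<open>0 < e\<close> z by (simp add: \<delta>_def)
    moreover have "x \<in> closure ((\<lambda>v. app S v - z *\<^sub>C v) ` D)" using core by simp
    ultimately obtain v where v: "v \<in> D" and close: "dist (app S v - z *\<^sub>C v) x < \<delta>"
      unfolding closure_approachable by blast
    obtain N where N: "\<And>n. n \<ge> N \<Longrightarrow> dist (app (T n) v) (app S v) < \<delta>"
      using metric_LIMSEQ_D [OF conv [OF v] \<open>0 < \<delta>\<close>] by blast
    have "dist (resolvent (T n) z x) (resolvent S z x) < e" if "n \<ge> N" for n
    proof -
      have "norm (resolvent S z x - v) \<le> norm (x - (app S v - z *\<^sub>C v)) / \<bar>Im z\<bar>"
        using S z D(1) v by (intro norm_resolvent_minus_le) auto
      also have "\<dots> < \<delta> / \<bar>Im z\<bar>"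
        using close z by (intro divide_strict_right_mono) (simp_all add: dist_norm norm_minus_commute)
      finally have 1: "norm (resolvent S z x - v) < \<delta> / \<bar>Im z\<bar>" .
      have "x - (app (T n) v - z *\<^sub>C v) = (x - (app S v - z *\<^sub>C v)) + (app S v - app (T n) v)"
        by simp
      then have "norm (x - (app (T n) v - z *\<^sub>C v))
          \<le> norm (x - (app S v - z *\<^sub>C v)) + norm (app S v - app (T n) v)"
        by (metis norm_triangle_ineq)
      also have "\<dots> < 2 * \<delta>"
        using close N [OF that] by (simp add: dist_norm norm_minus_commute)
      finally have "norm (x - (app (T n) v - z *\<^sub>C v)) / \<bar>Im z\<bar> < 2 * \<delta> / \<bar>Im z\<bar>"
        using z by (intro divide_strict_right_mono) simp_all
      moreover have "norm (resolvent (T n) z x - v)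
          \<le> norm (x - (app (T n) v - z *\<^sub>C v)) / \<bar>Im z\<bar>"
        using T z D(2) v by (intro norm_resolvent_minus_le) auto
      ultimately have 2: "norm (resolvent (T n) z x - v) < 2 * \<delta> / \<bar>Im z\<bar>" by linarith
      have "dist (resolvent (T n) z x) (resolvent S z x)
          \<le> norm (resolvent (T n) z x - v) + norm (resolvent S z x - v)"
        by (metis dist_norm dist_triangle2)
      also have "\<dots> < 2 * \<delta> / \<bar>Im z\<bar> + \<delta> / \<bar>Im z\<bar>" using 1 2 by linarith
      also have "\<dots> = e" using z by (simp add: \<delta>_def field_simps)
      finally show ?thesis .
    qed
    then show "\<exists>N. \<forall>n\<ge>N. dist (resolvent (T n) z x) (resolvent S z x) < e" by blast
  qed
  then show ?thesis using T S z unfolding strong_resolvent_convergence_def by blast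
qed


section \<open>Maximal matrix operators\<close>

lemma coord_app_matrix_operator:
  "v \<in> dom_of (matrix_operator B) \<Longrightarrow> coord (app (matrix_operator B) v) i = mat_vec B v i"
  by (simp add: matrix_operator_def Abs_ell2_inverse)

lemma linear_matrix_operator: "linear_operator (matrix_operator B)"
proof -
  let ?T = "matrix_operator B"
  have domD: "summable (\<lambda>j. B i j * coord v j)" "summable (\<lambda>i. (cmod (mat_vec B v i))\<^sup>2)"
    if "v \<in> dom_of ?T" for v i
    using that by (simp_all add: matrix_operator_def)
  have add: "mat_vec B (v + w) i = mat_vec B v i + mat_vec B w i"
    if "v \<in> dom_of ?T" "w \<in> dom_of ?T" for v w i
    using suminf_add [OF domD(1) [OF that(1)] domD(1) [OF that(2)], of i i]
    by (simp add: mat_vec_def plus_ell2.rep_eq distrib_left)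
  have scale: "mat_vec B (c *\<^sub>C v) i = c * mat_vec B v i" if "v \<in> dom_of ?T" for c v i
    using suminf_mult [OF domD(1) [OF that], of c i]
    by (simp add: mat_vec_def scaleC_ell2.rep_eq mult.left_commute)
  have add_dom: "v + w \<in> dom_of ?T" if "v \<in> dom_of ?T" "w \<in> dom_of ?T" for v w
    using summable_add [OF domD(1) [OF that(1)] domD(1) [OF that(2)]]
      square_summable_add [OF domD(2) [OF that(1)] domD(2) [OF that(2)]]
    by (simp add: matrix_operator_def add [OF that] plus_ell2.rep_eq distrib_left)
  have scale_dom: "c *\<^sub>C v \<in> dom_of ?T" if "v \<in> dom_of ?T" for c v
    using summable_mult [OF domD(1) [OF that], of c] square_summable_mult [OF domD(2) [OF that], of c]
    by (simp add: matrix_operator_def scale [OF that] scaleC_ell2.rep_eq mult.left_commute)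
  have "(0 :: ell2) \<in> dom_of ?T"
    by (simp add: matrix_operator_def mat_vec_def zero_ell2.rep_eq)
  then have "csubspace (dom_of ?T)"
    using add_dom scale_dom by (intro complex_vector.subspaceI)
  moreover have "app ?T (v + w) = app ?T v + app ?T w"
    if "v \<in> dom_of ?T" "w \<in> dom_of ?T" for v w
    by (rule ell2_eqI)
      (simp add: coord_app_matrix_operator add_dom that add plus_ell2.rep_eq)
  moreover have "app ?T (c *\<^sub>C v) = c *\<^sub>C app ?T v" if "v \<in> dom_of ?T" for c v
    by (rule ell2_eqI)
      (simp add: coord_app_matrix_operator scale_dom that scale scaleC_ell2.rep_eq)
  ultimately show ?thesis by (simp add: linear_operator_def)
qed

lemma cinner_std_basis: "cinner (std_basis j) v = coord v j"
proof -
  have "cinner (std_basis j) v = (\<Sum>i\<in>{j}. cnj (coord (std_basis j) i) * coord v i)"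
    unfolding cinner_ell2_def by (rule suminf_finite) (auto simp: std_basis.rep_eq)
  then show ?thesis by (simp add: std_basis.rep_eq)
qed

lemma mat_vec_std_basis: "mat_vec B (std_basis j) i = B i j"
proof -
  have "mat_vec B (std_basis j) i = (\<Sum>l\<in>{j}. B i l * coord (std_basis j) l)"
    unfolding mat_vec_def by (rule suminf_finite) (auto simp: std_basis.rep_eq)
  then show ?thesis by (simp add: std_basis.rep_eq)
qed

lemma std_basis_in_dom:
  assumes "summable (\<lambda>i. (cmod (B i j))\<^sup>2)"
  shows "std_basis j \<in> dom_of (matrix_operator B)"
proof -
  have "summable (\<lambda>l. B i l * coord (std_basis j) l)" for i
    by (rule summable_finite [of "{j}"]) (auto simp: std_basis.rep_eq)
  then show ?thesis using assms by (simp add: matrix_operator_def mat_vec_std_basis)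
qed

lemma ell2_finite_subset_dom:
  assumes "\<And>j. std_basis j \<in> dom_of (matrix_operator B)"
  shows "ell2_finite \<subseteq> dom_of (matrix_operator B)"
  unfolding ell2_finite_def
  using assms linear_matrix_operator [of B]
  by (intro complex_vector.span_minimal) (auto simp: linear_operator_def)

lemma self_adjoint_matrix_hermitian:
  assumes B: "self_adjoint (matrix_operator B)"
    and basis: "\<And>j. std_basis j \<in> dom_of (matrix_operator B)"
  shows "B i j = cnj (B j i)"
proof -
  have "B i j = cinner (std_basis i) (app (matrix_operator B) (std_basis j))"
    by (simp add: cinner_std_basis coord_app_matrix_operator basis mat_vec_std_basis)
  also have "\<dots> = cinner (app (matrix_operator B) (std_basis i)) (std_basis j)"
    by (rule self_adjoint_symmetric [OF B basis basis])
  also have "\<dots> = cnj (cinner (std_basis j) (app (matrix_operator B) (std_basis i)))"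
    by (rule cinner_commute)
  also have "\<dots> = cnj (B j i)"
    by (simp add: cinner_std_basis coord_app_matrix_operator basis mat_vec_std_basis)
  finally show ?thesis .
qed

text \<open>
  Here the maximality of the domain of \<open>matrix_operator B\<close> enters. If \<open>y\<close> is orthogonal to
  \<open>(B - z) e\<^sub>j\<close> for all \<open>j\<close>, then, as the rows of \<open>B\<close> are the conjugates of its columns, the
  formal product \<open>B y\<close> equals \<open>cnj z *\<^sub>C y\<close> coordinatewise. This product is square-summable, so
  \<open>y\<close> lies in the maximal domain and is an eigenvector for a nonreal eigenvalue.
\<close>

lemma ell2_finite_core:
  assumes B: "self_adjoint (matrix_operator B)"
    and basis: "\<And>j. std_basis j \<in> dom_of (matrix_operator B)"
    and z: "Im z \<noteq> 0"
  shows "closure ((\<lambda>v. app (matrix_operator B) v - z *\<^sub>C v) ` ell2_finite) = UNIV"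
proof (rule dense_if_orthogonal_complement_trivial)
  let ?T = "matrix_operator B"
  show "csubspace ((\<lambda>v. app ?T v - z *\<^sub>C v) ` ell2_finite)"
    by (intro csubspace_image_shifted_operator linear_matrix_operator
        ell2_finite_subset_dom [OF basis]) (simp add: ell2_finite_def)
  fix y assume perp: "\<And>x. x \<in> (\<lambda>v. app ?T v - z *\<^sub>C v) ` ell2_finite \<Longrightarrow> cinner y x = 0"
  have col: "cnj (coord (app ?T (std_basis j)) i) = B j i" for i j
    using self_adjoint_matrix_hermitian [OF B basis, of j i]
    by (simp add: coord_app_matrix_operator basis mat_vec_std_basis)
  have row: "summable (\<lambda>i. B j i * coord y i)" for j
    using summable_cnj_mult [OF summable_coord summable_coord, of "app ?T (std_basis j)" y]
    by (simp add: col)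
  have By: "mat_vec B y j = coord (cnj z *\<^sub>C y) j" for j
  proof -
    have "std_basis j \<in> ell2_finite"
      unfolding ell2_finite_def by (intro complex_vector.span_base) simp
    then have "cinner y (app ?T (std_basis j) - z *\<^sub>C std_basis j) = 0"
      by (intro perp imageI)
    then have "cinner y (app ?T (std_basis j)) = cinner (cnj z *\<^sub>C y) (std_basis j)"
      by (simp add: cinner_diff_right cinner_scaleC_right cinner_scaleC_left)
    then have "cinner (app ?T (std_basis j)) y = cinner (std_basis j) (cnj z *\<^sub>C y)"
      by (metis cinner_commute)
    then show ?thesis
      by (simp add: cinner_ell2_def [of "app ?T (std_basis j)"] col mat_vec_def cinner_std_basis)
  qed
  have "summable (\<lambda>i. (cmod (mat_vec B y i))\<^sup>2)"
    unfolding By by (rule summable_coord)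
  then have dom: "y \<in> dom_of ?T" using row by (simp add: matrix_operator_def)
  have "app ?T y = cnj z *\<^sub>C y"
    by (rule ell2_eqI) (simp only: coord_app_matrix_operator [OF dom] By)
  then show "y = 0" by (rule self_adjoint_no_nonreal_eigenvalue [OF B dom]) (use z in simp)
qed


section \<open>Finite sections\<close>

lemma self_adjoint_if_symmetric_on_UNIV:
  assumes lin: "linear_operator T" and dom: "dom_of T = UNIV"
    and sym: "\<And>x y. cinner y (app T x) = cinner (app T y) x"
  shows "self_adjoint T"
proof -
  have "app T y = z" if "\<And>x. cinner y (app T x) = cinner z x" for y z
  proof -
    have "app T y - z = 0"
      by (rule orthogonal_to_dense_imp_zero [of UNIV])
        (simp_all add: cinner_diff_left that flip: sym)
    then show ?thesis by simp
  qed
  then show ?thesis using lin sym unfolding self_adjoint_iff dom by auto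
qed

lemma coord_app_zero_extended_section:
  "coord (app (matrix_operator (zero_extended_section k B)) v) i
     = (if i < k then \<Sum>j<k. B i j * coord v j else 0)"
proof -
  have "mat_vec (zero_extended_section k B) v i
      = (\<Sum>j<k. zero_extended_section k B i j * coord v j)"
    unfolding mat_vec_def by (rule suminf_finite) (auto simp: zero_extended_section_def)
  then show ?thesis
    by (simp add: coord_app_matrix_operator dom_of_zero_extended_section zero_extended_section_def)
qed

lemma self_adjoint_zero_extended_section:
  assumes herm: "\<And>i j. B i j = cnj (B j i)"
  shows "self_adjoint (matrix_operator (zero_extended_section k B))"
proof (rule self_adjoint_if_symmetric_on_UNIV
    [OF linear_matrix_operator dom_of_zero_extended_section])
  fix v w :: ell2
  let ?T = "matrix_operator (zero_extended_section k B)"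
  have "cinner w (app ?T v) = (\<Sum>i<k. cnj (coord w i) * coord (app ?T v) i)"
    unfolding cinner_ell2_def
    by (rule suminf_finite) (auto simp: coord_app_zero_extended_section)
  also have "\<dots> = (\<Sum>i<k. \<Sum>j<k. cnj (coord w i) * (B i j * coord v j))"
    by (simp add: coord_app_zero_extended_section sum_distrib_left)
  also have "\<dots> = (\<Sum>j<k. \<Sum>i<k. cnj (coord w i) * (B i j * coord v j))"
    by (rule sum.swap)
  also have "\<dots> = (\<Sum>j<k. \<Sum>i<k. cnj (B j i * coord w i) * coord v j)"
  proof (intro sum.cong refl)
    fix i j
    show "cnj (coord w i) * (B i j * coord v j) = cnj (B j i * coord w i) * coord v j"
      using herm [of i j] by simp
  qed
  also have "\<dots> = (\<Sum>j<k. cnj (coord (app ?T w) j) * coord v j)"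
    by (simp add: coord_app_zero_extended_section sum_distrib_right)
  also have "\<dots> = cinner (app ?T w) v"
    unfolding cinner_ell2_def
    by (rule suminf_finite [symmetric]) (auto simp: coord_app_zero_extended_section)
  finally show "cinner w (app ?T v) = cinner (app ?T w) v" .
qed

lemma truncations_tendsto:
  assumes w: "\<And>n i. n \<ge> m \<Longrightarrow> coord (w n) i = (if i < n then coord u i else 0)"
  shows "w \<longlonglongrightarrow> u"
proof -
  let ?b = "\<lambda>i. (cmod (coord u i))\<^sup>2"
  have norm_eq: "(norm (w n - u))\<^sup>2 = suminf ?b - (\<Sum>i<n. ?b i)" if "n \<ge> m" for n
  proof -
    have "(\<lambda>i. ?b i - (if i \<in> {..<n} then ?b i else 0)) sums (suminf ?b - (\<Sum>i<n. ?b i))"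
      by (intro sums_diff summable_sums summable_coord sums_If_finite_set) simp
    moreover have "?b i - (if i \<in> {..<n} then ?b i else 0) = (cmod (coord (w n - u) i))\<^sup>2" for i
      by (simp add: coord_diff w that)
    ultimately show ?thesis unfolding norm_ell2_square by (simp add: sums_iff)
  qed
  have "(\<lambda>n. suminf ?b - (\<Sum>i<n. ?b i)) \<longlonglongrightarrow> suminf ?b - suminf ?b"
    by (intro tendsto_intros summable_LIMSEQ summable_coord)
  moreover have "\<forall>\<^sub>F n in sequentially. suminf ?b - (\<Sum>i<n. ?b i) = (norm (w n - u))\<^sup>2"
    using norm_eq unfolding eventually_sequentially by metis
  ultimately have "(\<lambda>n. (norm (w n - u))\<^sup>2) \<longlonglongrightarrow> suminf ?b - suminf ?b"
    by (rule Lim_transform_eventually)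
  then have "(\<lambda>n. (norm (w n - u))\<^sup>2) \<longlonglongrightarrow> 0" by simp
  then have "(\<lambda>n. sqrt ((norm (w n - u))\<^sup>2)) \<longlonglongrightarrow> sqrt 0"
    by (rule tendsto_real_sqrt)
  then show ?thesis
    by (simp add: tendsto_norm_zero_iff flip: LIM_zero_iff [of w u])
qed

text \<open>
  By linearity it suffices to consider \<open>e\<^sub>j\<close>. For \<open>k > j\<close> the section of size \<open>k\<close> maps it to
  the \<open>j\<close>-th column of \<open>B\<close> cut off after \<open>k\<close> entries.
\<close>

lemma zero_extended_section_tendsto:
  assumes basis: "\<And>j. std_basis j \<in> dom_of (matrix_operator B)" and v: "v \<in> ell2_finite"
  shows "(\<lambda>k. app (matrix_operator (zero_extended_section k B)) v)
           \<longlonglongrightarrow> app (matrix_operator B) v"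
proof -
  let ?T = "matrix_operator B" and ?S = "\<lambda>k. matrix_operator (zero_extended_section k B)"
  let ?C = "{v \<in> dom_of ?T. (\<lambda>k. app (?S k) v) \<longlonglongrightarrow> app ?T v}"
  have T: "csubspace (dom_of ?T)"
    "\<And>x y. x \<in> dom_of ?T \<Longrightarrow> y \<in> dom_of ?T \<Longrightarrow> app ?T (x + y) = app ?T x + app ?T y"
    "\<And>c x. x \<in> dom_of ?T \<Longrightarrow> app ?T (c *\<^sub>C x) = c *\<^sub>C app ?T x"
    using linear_matrix_operator [of B] unfolding linear_operator_def by blast+
  have S: "app (?S k) (x + y) = app (?S k) x + app (?S k) y"
    "app (?S k) (c *\<^sub>C x) = c *\<^sub>C app (?S k) x" for k c x y
    using linear_matrix_operator [of "zero_extended_section k B"]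
    unfolding linear_operator_def dom_of_zero_extended_section by blast+
  have "csubspace ?C"
  proof (rule complex_vector.subspaceI)
    show "c *\<^sub>C x \<in> ?C" if "x \<in> ?C" for c x
      using that by (auto simp: S T(3)
          intro!: complex_vector.subspace_scale [OF T(1)] tendsto_scaleC_right)
    show "x + y \<in> ?C" if "x \<in> ?C" "y \<in> ?C" for x y
      using that by (auto simp: S T(2)
          intro!: complex_vector.subspace_add [OF T(1)] tendsto_add)
    have 0: "0 \<in> dom_of ?T" using T(1) by (rule complex_vector.subspace_0)
    have "app ?T 0 = 0" "app (?S k) 0 = 0" for k
      using T(3) [OF 0, of 0] S(2) [of k 0 0] by simp_all
    then show "0 \<in> ?C" using 0 by simp
  qed
  moreover have "std_basis j \<in> ?C" for j
  proof -
    have "(\<lambda>k. app (?S k) (std_basis j)) \<longlonglongrightarrow> app ?T (std_basis j)"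
    proof (rule truncations_tendsto)
      fix k i :: nat assume "Suc j \<le> k"
      then have "(\<Sum>l<k. B i l * coord (std_basis j) l) = B i j"
        by (simp add: std_basis.rep_eq if_distrib sum.delta cong: if_cong)
      then show "coord (app (?S k) (std_basis j)) i
          = (if i < k then coord (app ?T (std_basis j)) i else 0)"
        by (simp add: coord_app_zero_extended_section coord_app_matrix_operator basis
            mat_vec_std_basis)
    qed
    then show ?thesis using basis by simp
  qed
  ultimately have "ell2_finite \<subseteq> ?C"
    unfolding ell2_finite_def by (intro complex_vector.span_minimal) auto
  then show ?thesis using v by blast
qed


section \<open>Matrices of operators\<close>

text \<open>
  With \<open>p\<close> the partial sum of the Fourier expansion of \<open>x\<close> and \<open>s\<close> the sum
  to be bounded, both \<open>cinner p x\<close> and \<open>cinner p p\<close> equal \<open>s\<close>, and the Cauchy-Schwarz inequality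
  gives \<open>s\<^sup>2 \<le> s * (norm x)\<^sup>2\<close>.
\<close>

lemma bessel_inequality:
  fixes \<phi> :: "nat \<Rightarrow> 'a::complex_inner"
  assumes ortho: "\<And>i j. cinner (\<phi> i) (\<phi> j) = (if i = j then 1 else 0)"
  shows "(\<Sum>i<n. (cmod (cinner (\<phi> i) x))\<^sup>2) \<le> (norm x)\<^sup>2"
proof -
  define s where "s = (\<Sum>i<n. (cmod (cinner (\<phi> i) x))\<^sup>2)"
  define p where "p = (\<Sum>i<n. cinner (\<phi> i) x *\<^sub>C \<phi> i)"
  have s: "complex_of_real s = (\<Sum>i<n. cnj (cinner (\<phi> i) x) * cinner (\<phi> i) x)"
    unfolding s_def of_real_sum complex_norm_square by (simp only: mult.commute)
  have px: "cinner p x = s"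
    by (simp add: p_def s cinner_sum_left cinner_scaleC_left)
  have "cinner p (\<phi> i) = cnj (cinner (\<phi> i) x)" if "i < n" for i
    using that by (simp add: p_def cinner_sum_left cinner_scaleC_left ortho if_distrib
        cong: if_cong)
  then have "cinner p p = s"
    by (subst (2) p_def) (simp add: s cinner_sum_right cinner_scaleC_right mult.commute)
  then have pp: "(norm p)\<^sup>2 = s" unfolding cinner_self of_real_eq_iff .
  have "0 \<le> s" by (simp flip: pp)
  then have "s \<le> norm p * norm x"
    using cmod_cinner_le [of p x] by (simp add: px)
  then have "s\<^sup>2 \<le> (norm p * norm x)\<^sup>2" using \<open>0 \<le> s\<close> by (intro power_mono)
  then have "s * s \<le> s * (norm x)\<^sup>2"
    by (simp only: power_mult_distrib pp power2_eq_square [of s])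
  then have "s \<le> (norm x)\<^sup>2" using \<open>0 \<le> s\<close> by (cases "s = 0") simp_all
  then show ?thesis by (simp add: s_def)
qed

lemma square_summable_infinite_matrix_column:
  assumes "orthonormal_basis \<phi>"
  shows "summable (\<lambda>i. (cmod (infinite_matrix A \<phi> i j))\<^sup>2)"
  unfolding infinite_matrix_def
  using assms
  by (intro summableI_nonneg_bounded [where x = "(norm (app A (\<phi> j)))\<^sup>2"] bessel_inequality)
    (simp_all add: orthonormal_basis_def)

theorem theorem6:
  fixes A :: "'h::chilbert_space unbounded_operator"
    and \<phi> :: "nat \<Rightarrow> 'h"
  assumes "self_adjoint A"
    and "has_matrix_representation A \<phi>"
  shows "(\<forall>v\<in>ell2_finite.
            v \<in> dom_of (matrix_operator (infinite_matrix A \<phi>)) \<and>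
            (\<lambda>n. app (matrix_operator (zero_extended_section (n + 1) (infinite_matrix A \<phi>))) v)
              \<longlonglongrightarrow> app (matrix_operator (infinite_matrix A \<phi>)) v) \<and>
         strong_resolvent_convergence
           (\<lambda>n. matrix_operator (zero_extended_section (n + 1) (infinite_matrix A \<phi>)))
           (matrix_operator (infinite_matrix A \<phi>))"
proof -
  let ?B = "infinite_matrix A \<phi>"
  have B: "self_adjoint (matrix_operator ?B)" and "orthonormal_basis \<phi>"
    using assms(2) by (simp_all add: has_matrix_representation_def)
  then have basis: "\<And>j. std_basis j \<in> dom_of (matrix_operator ?B)"
    by (intro std_basis_in_dom square_summable_infinite_matrix_column)
  note dom = ell2_finite_subset_dom [OF basis]
  have conv: "(\<lambda>n. app (matrix_operator (zero_extended_section (n + 1) ?B)) v)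
      \<longlonglongrightarrow> app (matrix_operator ?B) v" if "v \<in> ell2_finite" for v
    by (rule LIMSEQ_ignore_initial_segment [OF zero_extended_section_tendsto [OF basis that]])
  have "strong_resolvent_convergence
      (\<lambda>n. matrix_operator (zero_extended_section (n + 1) ?B)) (matrix_operator ?B)"
  proof (rule strong_resolvent_convergence_if_converges_on_core [where z = \<i>, OF _ B _ dom])
    show "self_adjoint (matrix_operator (zero_extended_section (n + 1) ?B))" for n
      by (intro self_adjoint_zero_extended_section self_adjoint_matrix_hermitian B basis)
    show "closure ((\<lambda>v. app (matrix_operator ?B) v - \<i> *\<^sub>C v) ` ell2_finite) = UNIV"
      by (rule ell2_finite_core [OF B basis]) simp_all
  qed (simp_all only: conv dom_of_zero_extended_section subset_UNIV, simp)
  then show ?thesis using conv dom by blast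
qed

end
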